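(* Let $T$ be a first-order theory in a countable language $L$, $\mathcal{U}$ a monster model of $T$, $M$ a small elementary substructure of $\mathcal{U}$, and $\varphi(x;y)$ an NIP partitioned $L$-formula. Then $\operatorname{conv}(\mathbb{F}^\varphi_M)\subseteq\mathbb{R}^{S_y(M)}$ is sequentially dependent.
   Context: NIP: $\varphi(x;y)$ is IP if for every $n$ there is $A\subseteq\mathcal{U}^x$ with $|A|\ge n$ such that every $K\subseteq A$ equals $\{c\in A:\mathcal{U}\models\varphi(c,b_K)\}$ for some $b_K\in\mathcal{U}^y$; NIP means not IP. $S_y(M)$ is the space of complete types in variables $y$ over $M$. For $a\in M^x$, $F^\varphi_a:S_y(M)\to\{0,1\}\subseteq\mathbb{R}$ is $F^\varphi_a(p)=1$ if $\varphi(a,y)\in p$ and $0$ otherwise; $\mathbb{F}^\varphi_M=\{F^\varphi_a:a\in M^x\}$, and $\operatorname{conv}(\mathbb{F}^\varphi_M)$ is its convex hull. A set $\mathbf{X}\subseteq\mathbb{R}^Y$ is sequentially independent if there exist a sequence $(f_n)_{n\in\mathbb{N}}$ in $\mathbf{X}$, $r\in\mathbb{R}$ and $\epsilon>0$ such that for every $I\subseteq\mathbb{N}$ there is $b_I\in Y$ with $\{n: f_n(b_I)\le r\}=I$ and $\{n: f_n(b_I)\ge r+\epsilon\}=\mathbb{N}\setminus I$; otherwise $\mathbf{X}$ is sequentially dependent. *)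

theory Defs
  imports "HOL-Analysis.Analysis" "HOL-Library.Function_Algebras"
begin

unbundle cardinal_syntax

section \<open>First-order languages, formulas and structures\<close>

record ('f, 'r) language =
  funs :: "'f set"
  rels :: "'r set"
  fun_arity :: "'f \<Rightarrow> nat"
  rel_arity :: "'r \<Rightarrow> nat"

definition countable_language :: "('f, 'r) language \<Rightarrow> bool" where
  "countable_language L \<longleftrightarrow> countable (funs L) \<and> countable (rels L)"

text \<open>Formulas may contain constants naming elements of a structure: \<open>Param a\<close> is the constant
  symbol for the element \<open>a\<close>. The formulas of the language \<open>L(A)\<close> are those whose parameters lie in
  the set \<open>A\<close>, and those of \<open>L\<close> itself are the ones without parameters. Constant symbols of \<open>L\<close> are
  function symbols of arity 0; equality is a logical symbol.\<close>

datatype ('f, 'a) trm =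
    Var nat
  | Param 'a
  | Fn 'f "('f, 'a) trm list"

datatype ('f, 'r, 'a) fm =
    Equal "('f, 'a) trm" "('f, 'a) trm"
  | Rel 'r "('f, 'a) trm list"
  | Neg "('f, 'r, 'a) fm"
  | Conj "('f, 'r, 'a) fm" "('f, 'r, 'a) fm"
  | Exi nat "('f, 'r, 'a) fm"

fun wf_trm :: "('f, 'r) language \<Rightarrow> 'a set \<Rightarrow> ('f, 'a) trm \<Rightarrow> bool" where
  "wf_trm L A (Var v) \<longleftrightarrow> True"
| "wf_trm L A (Param a) \<longleftrightarrow> a \<in> A"
| "wf_trm L A (Fn f ts) \<longleftrightarrow>
    f \<in> funs L \<and> length ts = fun_arity L f \<and> (\<forall>t\<in>set ts. wf_trm L A t)"

fun wf_fm :: "('f, 'r) language \<Rightarrow> 'a set \<Rightarrow> ('f, 'r, 'a) fm \<Rightarrow> bool" where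
  "wf_fm L A (Equal s t) \<longleftrightarrow> wf_trm L A s \<and> wf_trm L A t"
| "wf_fm L A (Rel R ts) \<longleftrightarrow>
    R \<in> rels L \<and> length ts = rel_arity L R \<and> (\<forall>t\<in>set ts. wf_trm L A t)"
| "wf_fm L A (Neg \<psi>) \<longleftrightarrow> wf_fm L A \<psi>"
| "wf_fm L A (Conj \<psi> \<theta>) \<longleftrightarrow> wf_fm L A \<psi> \<and> wf_fm L A \<theta>"
| "wf_fm L A (Exi v \<psi>) \<longleftrightarrow> wf_fm L A \<psi>"

fun fv_trm :: "('f, 'a) trm \<Rightarrow> nat set" where
  "fv_trm (Var v) = {v}"
| "fv_trm (Param a) = {}"
| "fv_trm (Fn f ts) = (\<Union>t\<in>set ts. fv_trm t)"

fun fv :: "('f, 'r, 'a) fm \<Rightarrow> nat set" where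
  "fv (Equal s t) = fv_trm s \<union> fv_trm t"
| "fv (Rel R ts) = (\<Union>t\<in>set ts. fv_trm t)"
| "fv (Neg \<psi>) = fv \<psi>"
| "fv (Conj \<psi> \<theta>) = fv \<psi> \<union> fv \<theta>"
| "fv (Exi v \<psi>) = fv \<psi> - {v}"

text \<open>A finite tuple of variables is represented by the finite set \<open>z\<close> of its variables, and the
  set \<open>S\<^sup>z\<close> of tuples from \<open>S\<close> by \<open>z \<rightarrow>\<^sub>E S\<close>.\<close>

definition formulas :: "('f, 'r) language \<Rightarrow> 'a set \<Rightarrow> nat set \<Rightarrow> ('f, 'r, 'a) fm set" where
  "formulas L A z = {\<psi>. wf_fm L A \<psi> \<and> fv \<psi> \<subseteq> z}"

record ('f, 'r, 'a) struct =
  univ :: "'a set"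
  fun_int :: "'f \<Rightarrow> 'a list \<Rightarrow> 'a"
  rel_int :: "'r \<Rightarrow> 'a list \<Rightarrow> bool"

definition structure_for :: "('f, 'r) language \<Rightarrow> ('f, 'r, 'a) struct \<Rightarrow> bool" where
  "structure_for L M \<longleftrightarrow> univ M \<noteq> {} \<and>
    (\<forall>f\<in>funs L. \<forall>as. length as = fun_arity L f \<longrightarrow> set as \<subseteq> univ M \<longrightarrow> fun_int M f as \<in> univ M)"

fun eval_trm :: "('f, 'r, 'a) struct \<Rightarrow> (nat \<Rightarrow> 'a) \<Rightarrow> ('f, 'a) trm \<Rightarrow> 'a" where
  "eval_trm M e (Var v) = e v"
| "eval_trm M e (Param a) = a"
| "eval_trm M e (Fn f ts) = fun_int M f (map (eval_trm M e) ts)"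

fun sat :: "('f, 'r, 'a) struct \<Rightarrow> (nat \<Rightarrow> 'a) \<Rightarrow> ('f, 'r, 'a) fm \<Rightarrow> bool" where
  "sat M e (Equal s t) \<longleftrightarrow> eval_trm M e s = eval_trm M e t"
| "sat M e (Rel R ts) \<longleftrightarrow> rel_int M R (map (eval_trm M e) ts)"
| "sat M e (Neg \<psi>) \<longleftrightarrow> \<not> sat M e \<psi>"
| "sat M e (Conj \<psi> \<theta>) \<longleftrightarrow> sat M e \<psi> \<and> sat M e \<theta>"
| "sat M e (Exi v \<psi>) \<longleftrightarrow> (\<exists>a\<in>univ M. sat M (e(v := a)) \<psi>)"

definition is_theory :: "('f, 'r) language \<Rightarrow> ('f, 'r, 'a) fm set \<Rightarrow> bool" where
  "is_theory L T \<longleftrightarrow> T \<subseteq> formulas L {} {}"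

definition models :: "('f, 'r, 'a) struct \<Rightarrow> ('f, 'r, 'a) fm set \<Rightarrow> bool" where
  "models M T \<longleftrightarrow> (\<forall>\<psi>\<in>T. \<forall>e. range e \<subseteq> univ M \<longrightarrow> sat M e \<psi>)"

definition elementary_substructure ::
    "('f, 'r) language \<Rightarrow> ('f, 'r, 'a) struct \<Rightarrow> ('f, 'r, 'a) struct \<Rightarrow> bool" where
  "elementary_substructure L M U \<longleftrightarrow>
    structure_for L M \<and> structure_for L U \<and> univ M \<subseteq> univ U \<and>
    (\<forall>f\<in>funs L. \<forall>as. length as = fun_arity L f \<longrightarrow> set as \<subseteq> univ M \<longrightarrow>
       fun_int M f as = fun_int U f as) \<and>
    (\<forall>R\<in>rels L. \<forall>as. length as = rel_arity L R \<longrightarrow> set as \<subseteq> univ M \<longrightarrow>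
       rel_int M R as = rel_int U R as) \<and>
    (\<forall>\<psi>\<in>formulas L {} UNIV. \<forall>e. range e \<subseteq> univ M \<longrightarrow> (sat M e \<psi> \<longleftrightarrow> sat U e \<psi>))"

section \<open>Types and monster models\<close>

text \<open>The complete types over a parameter set \<open>A\<close> in the variables \<open>z\<close>, computed in the ambient
  structure \<open>U\<close>. Finite satisfiability in \<open>U\<close> is consistency with the elementary diagram of \<open>U\<close>.\<close>

definition type_space ::
    "('f, 'r) language \<Rightarrow> ('f, 'r, 'a) struct \<Rightarrow> 'a set \<Rightarrow> nat set \<Rightarrow> ('f, 'r, 'a) fm set set" where
  "type_space L U A z = {p. p \<subseteq> formulas L A z \<and>
     (\<forall>q. finite q \<longrightarrow> q \<subseteq> p \<longrightarrow> (\<exists>b \<in> z \<rightarrow>\<^sub>E univ U. \<forall>\<psi>\<in>q. sat U b \<psi>)) \<and>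
     (\<forall>\<psi>\<in>formulas L A z. \<psi> \<in> p \<or> Neg \<psi> \<in> p)}"

definition saturated :: "('f, 'r) language \<Rightarrow> 'k rel \<Rightarrow> ('f, 'r, 'a) struct \<Rightarrow> bool" where
  "saturated L \<kappa> U \<longleftrightarrow>
    (\<forall>A z. A \<subseteq> univ U \<longrightarrow> |A| <o \<kappa> \<longrightarrow> finite z \<longrightarrow>
      (\<forall>p\<in>type_space L U A z. \<exists>b \<in> z \<rightarrow>\<^sub>E univ U. \<forall>\<psi>\<in>p. sat U b \<psi>))"

definition partial_elementary_map ::
    "('f, 'r) language \<Rightarrow> ('f, 'r, 'a) struct \<Rightarrow> 'a set \<Rightarrow> ('a \<Rightarrow> 'a) \<Rightarrow> bool" where
  "partial_elementary_map L U A g \<longleftrightarrow> A \<subseteq> univ U \<and> g ` A \<subseteq> univ U \<and>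
    (\<forall>\<psi>\<in>formulas L {} UNIV. \<forall>e. e ` fv \<psi> \<subseteq> A \<longrightarrow> (sat U e \<psi> \<longleftrightarrow> sat U (g \<circ> e) \<psi>))"

definition automorphism ::
    "('f, 'r) language \<Rightarrow> ('f, 'r, 'a) struct \<Rightarrow> ('a \<Rightarrow> 'a) \<Rightarrow> bool" where
  "automorphism L U h \<longleftrightarrow> bij_betw h (univ U) (univ U) \<and>
    (\<forall>f\<in>funs L. \<forall>as. length as = fun_arity L f \<longrightarrow> set as \<subseteq> univ U \<longrightarrow>
       h (fun_int U f as) = fun_int U f (map h as)) \<and>
    (\<forall>R\<in>rels L. \<forall>as. length as = rel_arity L R \<longrightarrow> set as \<subseteq> univ U \<longrightarrow>
       (rel_int U R as \<longleftrightarrow> rel_int U R (map h as)))"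

definition strongly_homogeneous :: "('f, 'r) language \<Rightarrow> 'k rel \<Rightarrow> ('f, 'r, 'a) struct \<Rightarrow> bool" where
  "strongly_homogeneous L \<kappa> U \<longleftrightarrow>
    (\<forall>A g. |A| <o \<kappa> \<longrightarrow> partial_elementary_map L U A g \<longrightarrow>
      (\<exists>h. automorphism L U h \<and> (\<forall>a\<in>A. h a = g a)))"

text \<open>The cardinal \<open>\<kappa>\<close> is the bound for smallness; it exceeds \<open>|L| + \<aleph>\<^sub>0\<close>.\<close>

definition monster_model ::
    "('f, 'r) language \<Rightarrow> ('f, 'r, 'a) fm set \<Rightarrow> 'k rel \<Rightarrow> ('f, 'r, 'a) struct \<Rightarrow> bool" where
  "monster_model L T \<kappa> U \<longleftrightarrow>
    Card_order \<kappa> \<and> natLeq <o \<kappa> \<and> |funs L| <o \<kappa> \<and> |rels L| <o \<kappa> \<and>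
    structure_for L U \<and> models U T \<and> saturated L \<kappa> U \<and> strongly_homogeneous L \<kappa> U"

definition small :: "'k rel \<Rightarrow> ('f, 'r, 'a) struct \<Rightarrow> bool" where
  "small \<kappa> M \<longleftrightarrow> |univ M| <o \<kappa>"

section \<open>Partitioned formulas and NIP\<close>

definition partitioned_formula ::
    "('f, 'r) language \<Rightarrow> nat set \<Rightarrow> nat set \<Rightarrow> ('f, 'r, 'a) fm \<Rightarrow> bool" where
  "partitioned_formula L x y \<phi> \<longleftrightarrow>
    finite x \<and> finite y \<and> x \<inter> y = {} \<and> \<phi> \<in> formulas L {} (x \<union> y)"

definition glue :: "nat set \<Rightarrow> (nat \<Rightarrow> 'a) \<Rightarrow> (nat \<Rightarrow> 'a) \<Rightarrow> nat \<Rightarrow> 'a" where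
  "glue x c b v = (if v \<in> x then c v else b v)"

text \<open>The disjunct \<open>infinite A\<close> is needed because \<open>card A = 0\<close> for infinite \<open>A\<close>.\<close>

definition IP :: "('f, 'r, 'a) struct \<Rightarrow> nat set \<Rightarrow> nat set \<Rightarrow> ('f, 'r, 'a) fm \<Rightarrow> bool" where
  "IP U x y \<phi> \<longleftrightarrow>
    (\<forall>n. \<exists>A. A \<subseteq> (x \<rightarrow>\<^sub>E univ U) \<and> (infinite A \<or> n \<le> card A) \<and>
      (\<forall>K\<subseteq>A. \<exists>b \<in> y \<rightarrow>\<^sub>E univ U. K = {c\<in>A. sat U (glue x c b) \<phi>}))"

definition NIP :: "('f, 'r, 'a) struct \<Rightarrow> nat set \<Rightarrow> nat set \<Rightarrow> ('f, 'r, 'a) fm \<Rightarrow> bool" where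
  "NIP U x y \<phi> \<longleftrightarrow> \<not> IP U x y \<phi>"

section \<open>The functions induced by a formula on the type space\<close>

text \<open>The formula \<open>\<phi>(a, y)\<close>: substitute the constants for \<open>a\<close> for the free occurrences of the
  variables \<open>x\<close>.\<close>

fun inst_trm :: "nat set \<Rightarrow> (nat \<Rightarrow> 'a) \<Rightarrow> ('f, 'a) trm \<Rightarrow> ('f, 'a) trm" where
  "inst_trm x a (Var v) = (if v \<in> x then Param (a v) else Var v)"
| "inst_trm x a (Param c) = Param c"
| "inst_trm x a (Fn f ts) = Fn f (map (inst_trm x a) ts)"

fun inst :: "nat set \<Rightarrow> (nat \<Rightarrow> 'a) \<Rightarrow> ('f, 'r, 'a) fm \<Rightarrow> ('f, 'r, 'a) fm" where
  "inst x a (Equal s t) = Equal (inst_trm x a s) (inst_trm x a t)"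
| "inst x a (Rel R ts) = Rel R (map (inst_trm x a) ts)"
| "inst x a (Neg \<psi>) = Neg (inst x a \<psi>)"
| "inst x a (Conj \<psi> \<theta>) = Conj (inst x a \<psi>) (inst x a \<theta>)"
| "inst x a (Exi v \<psi>) = Exi v (inst (x - {v}) a \<psi>)"

text \<open>\<open>\<real>\<^sup>Y\<close> for a set \<open>Y\<close> is represented by the functions that vanish outside \<open>Y\<close>.\<close>

definition type_fun ::
    "('f, 'r) language \<Rightarrow> ('f, 'r, 'a) struct \<Rightarrow> ('f, 'r, 'a) struct \<Rightarrow> nat set \<Rightarrow> nat set \<Rightarrow>
     ('f, 'r, 'a) fm \<Rightarrow> (nat \<Rightarrow> 'a) \<Rightarrow> ('f, 'r, 'a) fm set \<Rightarrow> real" where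
  "type_fun L U M x y \<phi> a p =
    (if p \<in> type_space L U (univ M) y \<and> inst x a \<phi> \<in> p then 1 else 0)"

definition type_funs ::
    "('f, 'r) language \<Rightarrow> ('f, 'r, 'a) struct \<Rightarrow> ('f, 'r, 'a) struct \<Rightarrow> nat set \<Rightarrow> nat set \<Rightarrow>
     ('f, 'r, 'a) fm \<Rightarrow> (('f, 'r, 'a) fm set \<Rightarrow> real) set" where
  "type_funs L U M x y \<phi> = {type_fun L U M x y \<phi> a | a. a \<in> x \<rightarrow>\<^sub>E univ M}"

section \<open>Convexity and sequential independence in spaces of functions\<close>

text \<open>Pointwise scalar multiplication; with it \<open>convex hull\<close> applies to sets of functions.\<close>

instantiation "fun" :: (type, real_vector) real_vector
begin

definition scaleR_fun :: "real \<Rightarrow> ('a \<Rightarrow> 'b) \<Rightarrow> 'a \<Rightarrow> 'b" where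
  "scaleR_fun r f = (\<lambda>x. r *\<^sub>R f x)"

instance
  by standard (auto simp: scaleR_fun_def fun_eq_iff scaleR_add_right scaleR_add_left)

end

definition seq_independent :: "'p set \<Rightarrow> ('p \<Rightarrow> real) set \<Rightarrow> bool" where
  "seq_independent Y X \<longleftrightarrow>
    (\<exists>(f :: nat \<Rightarrow> 'p \<Rightarrow> real) r \<epsilon>. (\<forall>n. f n \<in> X) \<and> \<epsilon> > 0 \<and>
      (\<forall>I. \<exists>b\<in>Y. {n. f n b \<le> r} = I \<and> {n. f n b \<ge> r + \<epsilon>} = UNIV - I))"

definition seq_dependent :: "'p set \<Rightarrow> ('p \<Rightarrow> real) set \<Rightarrow> bool" where
  "seq_dependent Y X \<longleftrightarrow> \<not> seq_independent Y X"

end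

theory Submission
  imports Defs "HOL-Real_Asymp.Real_Asymp"
begin

text \<open>Suppose \<open>f\<^sub>0, f\<^sub>1, \<dots>\<close> in the convex hull are independent at the levels \<open>r\<close>, \<open>r + \<epsilon>\<close>, witnessed
  by points \<open>b\<^sub>I\<close>. For each \<open>n\<close> only the \<open>2\<^sup>n\<close> points with \<open>I \<subseteq> {..<n}\<close> matter, so by a Chernoff-type
  bound each \<open>f\<^sub>k\<close> with \<open>k < n\<close> is, up to \<open>\<epsilon>/2\<close> at all of these points, an average of \<open>O(n)\<close> extreme
  points \<open>F\<^sub>a\<close>. The \<open>O(n\<^sup>2)\<close> extreme points obtained in this way separate the \<open>b\<^sub>I\<close>, hence cut out
  \<open>2\<^sup>n\<close> patterns, whereas by NIP and the Sauer--Shelah lemma the number of patterns is polynomial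
  in \<open>n\<close>.\<close>

section \<open>The Sauer--Shelah lemma\<close>

text \<open>Pajor's form: it passes through the induction on \<open>X\<close> without binomial sums.\<close>

lemma card_le_card_shattered:
  fixes X :: "'a set"
  assumes "finite X" "F \<subseteq> Pow X"
  shows "card F \<le> card {A. A \<subseteq> X \<and> (\<forall>K\<subseteq>A. \<exists>B\<in>F. K = A \<inter> B)}"
  using assms
proof (induction X arbitrary: F rule: finite_induct)
  case empty
  then have "F = {} \<or> F = {{}}" by auto
  then show ?case
  proof
    assume "F = {{}}"
    then have "{A. A \<subseteq> {} \<and> (\<forall>K\<subseteq>A. \<exists>B\<in>F. K = A \<inter> B)} = {{}}" by auto
    then show ?thesis using \<open>F = {{}}\<close> by simp
  qed simp
next
  case (insert x X)
  define Sh :: "'a set \<Rightarrow> 'a set set \<Rightarrow> 'a set set"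
    where "Sh = (\<lambda>Z G. {A. A \<subseteq> Z \<and> (\<forall>K\<subseteq>A. \<exists>B\<in>G. K = A \<inter> B)})"
  \<comment> \<open>\<open>F0\<close> and \<open>F1\<close> split \<open>F\<close> by membership of
    \<open>x\<close>. Deleting \<open>x\<close> is injective on the second half, so no set is lost
    in the count.\<close>
  define F0 where "F0 = {B\<in>F. x \<notin> B}"
  define F1 where "F1 = (\<lambda>B. B - {x}) ` {B\<in>F. x \<in> B}"
  have sub: "F0 \<subseteq> Pow X" "F1 \<subseteq> Pow X"
    using insert.prems by (auto simp: F0_def F1_def)
  have finF: "finite F"
    using insert.prems insert.hyps finite_subset by blast
  have inj: "inj_on (\<lambda>B. B - {x}) {B\<in>F. x \<in> B}"
    by (rule inj_onI) blast
  have "card F = card F0 + card {B\<in>F. x \<in> B}"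
    unfolding F0_def using finF
    by (subst card_Un_disjoint[symmetric]) (auto intro: arg_cong[where f = card])
  then have cF: "card F = card F0 + card F1"
    unfolding F1_def using card_image[OF inj] by simp
  have fin: "finite (Sh Z G)" if "finite Z" for Z G
    using that by (auto simp: Sh_def intro: finite_subset[of _ "Pow Z"])
  \<comment> \<open>A set shattered by either half is shattered by \<open>F\<close>. One shattered
    by both stays shattered after adding \<open>x\<close>, since \<open>F1\<close> supplies the
    traces containing \<open>x\<close> and \<open>F0\<close> the others. So a set counted in both
    halves yields two shattered sets.\<close>
  let ?U = "Sh X F0 \<union> Sh X F1" and ?V = "insert x ` (Sh X F0 \<inter> Sh X F1)"
  have notin: "x \<notin> A" if "A \<in> Sh X G" for A G
    using that insert.hyps by (auto simp: Sh_def)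
  have U: "?U \<subseteq> Sh (insert x X) F"
  proof
    fix A assume A: "A \<in> ?U"
    then have x: "x \<notin> A" using notin by blast
    have "\<exists>B\<in>F. K = A \<inter> B" if "K \<subseteq> A" for K
    proof -
      from A that obtain B where "B \<in> F0 \<union> F1" "K = A \<inter> B" unfolding Sh_def by blast
      then obtain B' where "B' \<in> F" "B' - {x} = B - {x}" unfolding F0_def F1_def by auto
      then show ?thesis using \<open>K = A \<inter> B\<close> x by blast
    qed
    then show "A \<in> Sh (insert x X) F" using A unfolding Sh_def by blast
  qed
  have V: "?V \<subseteq> Sh (insert x X) F"
  proof
    fix A' assume "A' \<in> ?V"
    then obtain A where A: "A' = insert x A" "A \<in> Sh X F0" "A \<in> Sh X F1" by blast
    have "\<exists>B\<in>F. K = A' \<inter> B" if "K \<subseteq> A'" for K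
    proof (cases "x \<in> K")
      case True
      have "K - {x} \<subseteq> A" using that A(1) by blast
      then obtain B where "B \<in> F1" "K - {x} = A \<inter> B" using A(3) unfolding Sh_def by blast
      then obtain B' where "B' \<in> F" "x \<in> B'" "B' - {x} = B" unfolding F1_def by auto
      then show ?thesis using \<open>K - {x} = A \<inter> B\<close> True A(1) notin[OF A(2)] by blast
    next
      case False
      then have "K \<subseteq> A" using that A(1) by blast
      then obtain B where "B \<in> F0" "K = A \<inter> B" using A(2) unfolding Sh_def by blast
      then show ?thesis using A(1) unfolding F0_def by blast
    qed
    then show "A' \<in> Sh (insert x X) F" using A unfolding Sh_def by blast
  qed
  have "inj_on (insert x) (Sh X F0 \<inter> Sh X F1)"
    using notin by (intro inj_onI) (metis Diff_insert_absorb IntD1)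
  then have cV: "card ?V = card (Sh X F0 \<inter> Sh X F1)" by (rule card_image)
  have "card F \<le> card (Sh X F0) + card (Sh X F1)"
    using insert.IH[OF sub(1)] insert.IH[OF sub(2)] cF unfolding Sh_def by linarith
  also have "\<dots> = card ?U + card ?V"
    using card_Un_Int[OF fin fin, OF insert.hyps(1) insert.hyps(1)] cV by simp
  also have "\<dots> = card (?U \<union> ?V)"
    using fin[OF insert.hyps(1)] notin by (intro card_Un_disjoint[symmetric]) auto
  also have "\<dots> \<le> card (Sh (insert x X) F)"
    using U V fin[of "insert x X"] insert.hyps by (intro card_mono) auto
  finally show ?case unfolding Sh_def .
qed

text \<open>Every nonempty set counted for \<open>Suc d\<close> arises by inserting a point of
  \<open>X\<close> into a set counted for \<open>d\<close>. Raising \<open>d\<close> by one thus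
  multiplies the count by at most \<open>card X\<close> and adds one for the empty set.\<close>

lemma card_subsets_card_less_le:
  assumes "finite X"
  shows "card {A. A \<subseteq> X \<and> card A < d} \<le> (card X + 1) ^ d"
proof (induction d)
  case 0
  then show ?case by simp
next
  case (Suc d)
  let ?P = "{A. A \<subseteq> X \<and> card A < d}"
  have finP: "finite ?P" using assms by (auto intro: finite_subset[of _ "Pow X"])
  have "{A. A \<subseteq> X \<and> card A < Suc d} \<subseteq> insert {} ((\<lambda>(x, A). insert x A) ` (X \<times> ?P))"
  proof
    fix A assume "A \<in> {A. A \<subseteq> X \<and> card A < Suc d}"
    then have A: "A \<subseteq> X" "card A < Suc d" by auto
    show "A \<in> insert {} ((\<lambda>(x, A). insert x A) ` (X \<times> ?P))"
    proof (cases "A = {}")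
      case False
      then obtain x where x: "x \<in> A" by blast
      have "finite A" using A assms finite_subset by blast
      then have "card (A - {x}) < card A" using x by (rule card_Diff1_less)
      then have "(x, A - {x}) \<in> X \<times> ?P" using A x by auto
      moreover have "A = (\<lambda>(x, A). insert x A) (x, A - {x})" using x by auto
      ultimately show ?thesis by blast
    qed simp
  qed
  then have "card {A. A \<subseteq> X \<and> card A < Suc d}
      \<le> card (insert {} ((\<lambda>(x, A). insert x A) ` (X \<times> ?P)))"
    using assms finP by (intro card_mono) auto
  also have "\<dots> \<le> Suc (card ((\<lambda>(x, A). insert x A) ` (X \<times> ?P)))"
    by (rule card_insert_le_m1) auto
  also have "\<dots> \<le> Suc (card (X \<times> ?P))"
    using assms finP by (intro Suc_leI le_imp_less_Suc card_image_le) auto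
  also have "\<dots> = Suc (card X * card ?P)" by (simp add: card_cartesian_product)
  also have "\<dots> \<le> (card X + 1) ^ d + card X * (card X + 1) ^ d"
    using mult_le_mono2[OF Suc.IH, of "card X"] one_le_power[of "card X + 1" d] by linarith
  finally show ?case by (simp add: algebra_simps)
qed

lemma sauer_shelah:
  assumes "finite X" "F \<subseteq> Pow X"
    and "\<And>A. A \<subseteq> X \<Longrightarrow> \<forall>K\<subseteq>A. \<exists>B\<in>F. K = A \<inter> B \<Longrightarrow> card A < d"
  shows "card F \<le> (card X + 1) ^ d"
proof -
  have "card F \<le> card {A. A \<subseteq> X \<and> (\<forall>K\<subseteq>A. \<exists>B\<in>F. K = A \<inter> B)}"
    using assms(1,2) by (rule card_le_card_shattered)
  also have "\<dots> \<le> card {A. A \<subseteq> X \<and> card A < d}"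
    using assms by (intro card_mono) (auto intro: finite_subset[of _ "Pow X"])
  also have "\<dots> \<le> (card X + 1) ^ d"
    using assms(1) by (rule card_subsets_card_less_le)
  finally show ?thesis .
qed

section \<open>Approximating convex combinations by short averages\<close>

lemma exp_le_quadratic:
  fixes u :: real
  assumes "\<bar>u\<bar> \<le> 1"
  shows "exp u \<le> 1 + u + u\<^sup>2"
proof (cases "u \<ge> 0")
  case True
  then show ?thesis using assms exp_bound[of u] by simp
next
  case False
  \<comment> \<open>The product equals \<open>1 - u ^ 3\<close>, and \<open>u\<close> is negative
    here.\<close>
  have "1 \<le> (1 + u + u\<^sup>2) * (1 - u)"
    using False by (simp add: algebra_simps power2_eq_square mult_nonneg_nonpos2 mult_nonneg_nonpos)
  also have "\<dots> \<le> (1 + u + u\<^sup>2) * exp (- u)"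
    using exp_ge_add_one_self[of "- u"] assms
    by (intro mult_left_mono) (auto intro: add_nonneg_nonneg)
  finally show ?thesis by (simp add: exp_minus field_simps)
qed

text \<open>If a linear functional were smaller on all of \<open>S\<close> than at \<open>f\<close>,
  the open half-space below its value at \<open>f\<close> would be convex and contain
  \<open>S\<close>, hence \<open>f\<close> itself. This replaces the argument that some outcome is
  at least as good as the expectation.\<close>

lemma convex_hull_ex_sum_ge:
  fixes f :: "'p \<Rightarrow> real"
  assumes "f \<in> convex hull S"
  shows "\<exists>g\<in>S. (\<Sum>b\<in>B. w b * f b) \<le> (\<Sum>b\<in>B. w b * g b)"
proof (rule ccontr)
  define \<Lambda> where "\<Lambda> = (\<lambda>h :: 'p \<Rightarrow> real. \<Sum>b\<in>B. w b * h b)"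
  have "linear \<Lambda>"
    by (rule linearI)
      (simp_all add: \<Lambda>_def scaleR_fun_def algebra_simps sum.distrib sum_distrib_left)
  then have "convex (\<Lambda> -` {..<\<Lambda> f})"
    by (rule convex_linear_vimage) simp
  moreover assume "\<not> ?thesis"
  then have "S \<subseteq> \<Lambda> -` {..<\<Lambda> f}" by (auto simp: \<Lambda>_def not_le)
  ultimately have "convex hull S \<subseteq> \<Lambda> -` {..<\<Lambda> f}" by (rule hull_minimal[rotated])
  then show False using assms by auto
qed

text \<open>Chernoff's bound, derandomised by the method of conditional expectations: the points \<open>g i\<close>
  are chosen one at a time so that the exponential potential grows by a factor of at most
  \<open>exp (\<eta>\<^sup>2)\<close>.\<close>

lemma convex_hull_exp_potential:
  fixes f :: "'p \<Rightarrow> real" and \<eta> :: real and m :: nat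
  assumes f: "f \<in> convex hull S" and B: "finite B"
    and diff: "\<And>g b. g \<in> S \<Longrightarrow> b \<in> B \<Longrightarrow> \<bar>f b - g b\<bar> \<le> 1"
    and s: "\<And>b. \<bar>s b\<bar> \<le> 1" and \<eta>: "0 \<le> \<eta>" "\<eta> \<le> 1"
  shows "\<exists>g. (\<forall>i<m. g i \<in> S) \<and>
    (\<Sum>b\<in>B. exp (\<eta> * s b * (\<Sum>i<m. f b - g i b))) \<le> card B * exp (m * \<eta>\<^sup>2)"
proof (induction m)
  case 0
  then show ?case by simp
next
  case (Suc m)
  then obtain g where g: "\<forall>i<m. g i \<in> S"
    and le: "(\<Sum>b\<in>B. exp (\<eta> * s b * (\<Sum>i<m. f b - g i b))) \<le> card B * exp (m * \<eta>\<^sup>2)" by blast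
  define W where "W = (\<lambda>b. exp (\<eta> * s b * (\<Sum>i<m. f b - g i b)))"
  \<comment> \<open>With these weights the first-order terms of the new potential sum to at most
    zero, leaving the factor \<open>1 + \<eta>\<^sup>2\<close>.\<close>
  obtain h where h: "h \<in> S" "(\<Sum>b\<in>B. W b * s b * f b) \<le> (\<Sum>b\<in>B. W b * s b * h b)"
    using convex_hull_ex_sum_ge[OF f, where B = B and w = "\<lambda>b. W b * s b"] by blast
  have step: "exp (\<eta> * s b * (f b - h b)) \<le> 1 + \<eta> * s b * (f b - h b) + \<eta>\<^sup>2" if "b \<in> B" for b
  proof -
    have sd: "\<bar>s b * (f b - h b)\<bar> \<le> 1"
      using s[of b] diff[OF h(1) that] by (simp add: abs_mult mult_le_one)
    then have "\<bar>\<eta> * s b * (f b - h b)\<bar> \<le> 1"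
      using \<eta> by (simp add: abs_mult mult.assoc mult_le_one)
    then have "exp (\<eta> * s b * (f b - h b))
        \<le> 1 + \<eta> * s b * (f b - h b) + (\<eta> * s b * (f b - h b))\<^sup>2"
      by (rule exp_le_quadratic)
    also have "(\<eta> * s b * (f b - h b))\<^sup>2 = \<eta>\<^sup>2 * (s b * (f b - h b))\<^sup>2"
      by (simp add: power_mult_distrib)
    also have "\<dots> \<le> \<eta>\<^sup>2 * 1"
      using sd by (intro mult_left_mono) (auto simp: abs_square_le_1)
    finally show ?thesis by simp
  qed
  have "(\<Sum>b\<in>B. exp (\<eta> * s b * (\<Sum>i<Suc m. f b - (g(m := h)) i b)))
      = (\<Sum>b\<in>B. W b * exp (\<eta> * s b * (f b - h b)))"
    by (simp add: W_def exp_add[symmetric] algebra_simps)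
  also have "\<dots> \<le> (\<Sum>b\<in>B. W b * (1 + \<eta> * s b * (f b - h b) + \<eta>\<^sup>2))"
    using step by (intro sum_mono mult_left_mono) (auto simp: W_def)
  also have "\<dots> = (1 + \<eta>\<^sup>2) * (\<Sum>b\<in>B. W b)
      + \<eta> * ((\<Sum>b\<in>B. W b * s b * f b) - (\<Sum>b\<in>B. W b * s b * h b))"
    by (simp add: algebra_simps sum.distrib sum_distrib_left sum_distrib_right sum_subtractf)
  also have "\<dots> \<le> (1 + \<eta>\<^sup>2) * (\<Sum>b\<in>B. W b)"
    using h(2) \<eta> by (simp add: mult_nonneg_nonpos)
  also have "\<dots> \<le> exp (\<eta>\<^sup>2) * (card B * exp (m * \<eta>\<^sup>2))"
    using le exp_ge_add_one_self[of "\<eta>\<^sup>2"]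
    by (intro mult_mono) (auto simp: W_def intro: sum_nonneg)
  also have "\<dots> = card B * exp (Suc m * \<eta>\<^sup>2)"
    by (simp add: exp_add[symmetric] algebra_simps)
  finally show ?case using g h(1)
    by (intro exI[of _ "g(m := h)"]) (auto simp: less_Suc_eq)
qed

lemma two_less_exp_1: "2 < exp (1 :: real)"
  using exp_ge_one_plus_x_over_n_power_n[of 2 1] by (simp add: power2_eq_square)

text \<open>Each term is at most the whole potential, which starts at \<open>card B\<close>. A
  length linear in \<open>n\<close> lets the growth exponent absorb this initial factor of at most
  \<open>2 ^ n\<close>. The signs \<open>s\<close> select which side of the error is controlled at
  each point.\<close>

lemma convex_hull_average_approx:
  fixes f :: "'p \<Rightarrow> real" and \<epsilon> :: real
  assumes f: "f \<in> convex hull S" and B: "finite B" "card B \<le> 2 ^ n"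
    and diff: "\<And>g b. g \<in> S \<Longrightarrow> b \<in> B \<Longrightarrow> \<bar>f b - g b\<bar> \<le> 1"
    and s: "\<And>b. \<bar>s b\<bar> \<le> 1" and \<epsilon>: "0 < \<epsilon>" "\<epsilon> \<le> 1"
    and n: "0 < n" and C: "16 / \<epsilon>\<^sup>2 \<le> real C"
  shows "\<exists>g. (\<forall>i<C * n. g i \<in> S) \<and>
    (\<forall>b\<in>B. s b * (\<Sum>i<C * n. f b - g i b) < \<epsilon> / 2 * real (C * n))"
proof -
  \<comment> \<open>Then \<open>C * \<eta>\<^sup>2\<close> is at least 1, so the total exponent is
    at most \<open>2 * (C * n) * \<eta>\<^sup>2\<close>, and \<open>2 * \<eta>\<close> is the
    tolerance \<open>\<epsilon> / 2\<close>.\<close>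
  define \<eta> where "\<eta> = \<epsilon> / 4"
  have \<eta>: "0 < \<eta>" "\<eta> \<le> 1" using \<epsilon> by (auto simp: \<eta>_def)
  let ?m = "C * n"
  obtain g where g: "\<forall>i<?m. g i \<in> S"
    and le: "(\<Sum>b\<in>B. exp (\<eta> * s b * (\<Sum>i<?m. f b - g i b))) \<le> card B * exp (?m * \<eta>\<^sup>2)"
    using convex_hull_exp_potential[where m = ?m and \<eta> = \<eta> and f = f and S = S and B = B and s = s]
      f B(1) diff s \<eta> by auto
  have "s b * (\<Sum>i<?m. f b - g i b) < \<epsilon> / 2 * real ?m" if b: "b \<in> B" for b
  proof -
    let ?t = "s b * (\<Sum>i<?m. f b - g i b)"
    have "exp (\<eta> * ?t) \<le> (\<Sum>b\<in>B. exp (\<eta> * s b * (\<Sum>i<?m. f b - g i b)))"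
      using member_le_sum[OF b, of "\<lambda>b. exp (\<eta> * s b * (\<Sum>i<?m. f b - g i b))"] B(1)
      by (simp add: mult.assoc)
    also have "\<dots> \<le> card B * exp (?m * \<eta>\<^sup>2)" by (rule le)
    also have "\<dots> \<le> 2 ^ n * exp (?m * \<eta>\<^sup>2)"
      using of_nat_mono[OF B(2), where 'a = real] by (intro mult_right_mono) auto
    also have "\<dots> < exp 1 ^ n * exp (?m * \<eta>\<^sup>2)"
      using n power_strict_mono[OF two_less_exp_1, of n] by simp
    also have "\<dots> = exp (real n + ?m * \<eta>\<^sup>2)"
      by (simp add: exp_add exp_of_nat_mult[symmetric])
    finally have "\<eta> * ?t < real n + ?m * \<eta>\<^sup>2" by simp
    also have "real n \<le> ?m * \<eta>\<^sup>2"
    proof -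
      have "1 \<le> C * \<eta>\<^sup>2" using C \<epsilon> by (simp add: \<eta>_def field_simps)
      then show ?thesis using mult_left_mono[of 1 "C * \<eta>\<^sup>2" "real n"] by (simp add: algebra_simps)
    qed
    finally have "\<eta> * ?t < \<eta> * (\<epsilon> / 2 * real ?m)"
      by (simp add: \<eta>_def power2_eq_square)
    then show ?thesis using \<eta> by simp
  qed
  then show ?thesis using g by blast
qed

section \<open>From bounded shattering to sequential dependence of the convex hull\<close>

lemma polynomial_less_two_power:
  "\<exists>n>0. (C * n\<^sup>2 + 1) ^ d < (2 :: nat) ^ n"
proof -
  \<comment> \<open>For positive \<open>n\<close> the monomial \<open>(C + 1) * n ^ 2\<close>
    dominates \<open>C * n ^ 2 + 1\<close>, so it suffices to compare its power with
    \<open>2 ^ n\<close>.\<close>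
  have ev: "\<forall>\<^sub>F n :: nat in sequentially. (real (C + 1) * real n ^ 2) ^ d < 2 ^ n"
    by real_asymp
  have "\<forall>\<^sub>F n in sequentially. 0 < n \<and> (real (C + 1) * real n ^ 2) ^ d < 2 ^ n"
    by (rule eventually_conj[OF eventually_gt_at_top ev])
  then obtain n where n: "n > 0" "(real (C + 1) * real n ^ 2) ^ d < 2 ^ n"
    by (auto simp only: eventually_sequentially)
  have "real ((C * n\<^sup>2 + 1) ^ d) \<le> (real (C + 1) * real n ^ 2) ^ d"
    using n(1) by (auto simp: algebra_simps intro!: power_mono)
  also have "\<dots> < real (2 ^ n)" using n(2) by simp
  finally show ?thesis using n(1) by (auto simp only: of_nat_less_iff)
qed

text \<open>The hypothesis \<open>vc\<close> is a VC bound with the functions in \<open>S\<close> as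
  ground set and the points of \<open>Y\<close> as the sets; model theory enters only through
  it.\<close>

lemma convex_hull_seq_dependent:
  fixes S :: "('p \<Rightarrow> real) set"
  assumes S01: "\<And>g b. g \<in> S \<Longrightarrow> g b \<in> {0, 1}"
    and vc: "\<And>A. finite A \<Longrightarrow> A \<subseteq> S \<Longrightarrow> \<forall>K\<subseteq>A. \<exists>b\<in>Y. K = {g\<in>A. g b = 1} \<Longrightarrow> card A < d"
  shows "seq_dependent Y (convex hull S)"
  unfolding seq_dependent_def
proof
  assume "seq_independent Y (convex hull S)"
  then obtain f :: "nat \<Rightarrow> 'p \<Rightarrow> real" and r \<epsilon>' where f: "\<And>k. f k \<in> convex hull S" and "\<epsilon>' > 0"
    and ind: "\<forall>I. \<exists>b\<in>Y. {k. f k b \<le> r} = I \<and> {k. f k b \<ge> r + \<epsilon>'} = UNIV - I"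
    unfolding seq_independent_def by (elim exE conjE) (rule that; (erule spec | assumption))
  from ind have "\<exists>b. \<forall>I. b I \<in> Y \<and> {k. f k (b I) \<le> r} = I \<and> {k. f k (b I) \<ge> r + \<epsilon>'} = UNIV - I"
    unfolding Bex_def by (rule choice)
  then obtain b where
    b: "\<forall>I. b I \<in> Y \<and> {k. f k (b I) \<le> r} = I \<and> {k. f k (b I) \<ge> r + \<epsilon>'} = UNIV - I" ..
  have bY: "b I \<in> Y" and b1: "{k. f k (b I) \<le> r} = I"
    and b2: "{k. f k (b I) \<ge> r + \<epsilon>'} = UNIV - I" for I
    using spec[OF b, of I] by simp_all
  \<comment> \<open>The approximation lemma requires a gap of at most 1; shrinking the gap preserves
    the separation.\<close>
  define \<epsilon> where "\<epsilon> = min \<epsilon>' 1"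
  have \<epsilon>: "0 < \<epsilon>" "\<epsilon> \<le> 1" using \<open>\<epsilon>' > 0\<close> by (auto simp: \<epsilon>_def)
  have low: "f k (b I) \<le> r" if "k \<in> I" for k I using b1[of I] that by blast
  have high: "r + \<epsilon> \<le> f k (b I)" if "k \<notin> I" for k I
  proof -
    have "r + \<epsilon>' \<le> f k (b I)" using b2[of I] that by blast
    then show ?thesis by (simp add: \<epsilon>_def)
  qed
  \<comment> \<open>One-point sums with weights 1 and -1 give members of \<open>S\<close> above and
    below \<open>f k\<close> at \<open>p\<close>.\<close>
  have f01: "0 \<le> f k p \<and> f k p \<le> 1" for k p
  proof -
    obtain g h where "g \<in> S" "f k p \<le> g p" "h \<in> S" "h p \<le> f k p"
      using convex_hull_ex_sum_ge[OF f[of k], where B = "{p}" and w = "\<lambda>_. 1"]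
        convex_hull_ex_sum_ge[OF f[of k], where B = "{p}" and w = "\<lambda>_. -1"] by auto
    then show ?thesis using S01[of g p] S01[of h p] by auto
  qed
  define C where "C = nat \<lceil>16 / \<epsilon>\<^sup>2\<rceil>"
  have C: "16 / \<epsilon>\<^sup>2 \<le> real C" unfolding C_def by linarith
  obtain n where n: "0 < n" and big: "(C * n\<^sup>2 + 1) ^ d < (2 :: nat) ^ n"
    using polynomial_less_two_power by blast
  let ?m = "C * n"
  define B where "B = b ` Pow {..<n}"
  have B: "finite B" "card B \<le> 2 ^ n"
    using card_image_le[of "Pow {..<n}" b] by (auto simp: B_def card_Pow)
  \<comment> \<open>Where \<open>f k\<close> is low the average of the \<open>g k i\<close> needs an
    upper bound, elsewhere a lower bound; the sign turns both into one inequality.\<close>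
  define s where "s = (\<lambda>k p. if f k p \<le> r then - 1 else 1 :: real)"
  have ex: "\<exists>g. (\<forall>i<?m. g i \<in> S) \<and>
      (\<forall>p\<in>B. s k p * (\<Sum>i<?m. f k p - g i p) < \<epsilon> / 2 * real ?m)" for k
  proof (rule convex_hull_average_approx[OF f B _ _ \<epsilon> n C])
    show "\<bar>f k p - g p\<bar> \<le> 1" if "g \<in> S" for g p
      using S01[OF that, of p] f01[of k p] by auto
  qed (simp add: s_def)
  obtain g where g: "\<forall>k. (\<forall>i<?m. g k i \<in> S) \<and>
      (\<forall>p\<in>B. s k p * (\<Sum>i<?m. f k p - g k i p) < \<epsilon> / 2 * real ?m)"
    using choice[OF allI[OF ex]] ..
  have gS: "g k i \<in> S" if "i < ?m" for k i using g that by blast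
  have approx: "s k p * (\<Sum>i<?m. f k p - g k i p) < \<epsilon> / 2 * real ?m" if "p \<in> B" for k p
    using g that by blast
  define X where "X = (\<lambda>(k, i). g k i) ` ({..<n} \<times> {..<?m})"
  have X: "finite X" "X \<subseteq> S" using gS by (auto simp: X_def)
  have "card X \<le> n * ?m"
    unfolding X_def using card_image_le[of "{..<n} \<times> {..<?m}" "\<lambda>(k, i). g k i"]
    by (simp add: card_cartesian_product)
  then have cX: "card X \<le> C * n\<^sup>2" by (simp add: power2_eq_square algebra_simps)
  define P where "P = (\<lambda>I. {h\<in>X. h (b I) = 1})"
  \<comment> \<open>For \<open>k\<close> in \<open>I\<close> but not in \<open>J\<close>, the
    average of the \<open>g k i\<close> is below \<open>r + \<epsilon> / 2\<close> at
    \<open>b I\<close> and above it at \<open>b J\<close>, yet equal patterns force equal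
    averages.\<close>
  have sep: "I \<subseteq> J" if I: "I \<subseteq> {..<n}" and J: "J \<subseteq> {..<n}" and eq: "P I = P J" for I J
  proof (rule subsetI, rule ccontr)
    fix k assume k: "k \<in> I" "k \<notin> J"
    have same: "g k i (b I) = g k i (b J)" if "i < ?m" for i
    proof -
      have "g k i \<in> X" using k I that by (force simp: X_def)
      then have "g k i (b I) = 1 \<longleftrightarrow> g k i (b J) = 1" using eq unfolding P_def by blast
      then show ?thesis using S01[OF gS[OF that], of k "b I"] S01[OF gS[OF that], of k "b J"] by auto
    qed
    have sI: "s k (b I) = - 1" and sJ: "s k (b J) = 1"
      using low[OF k(1)] high[OF k(2)] \<epsilon> by (auto simp: s_def)
    have "(\<Sum>i<?m. g k i (b I)) < real ?m * f k (b I) + \<epsilon> / 2 * real ?m"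
      using approx[of "b I" k] I sI by (simp add: B_def sum_subtractf)
    also have "\<dots> \<le> real ?m * r + \<epsilon> / 2 * real ?m"
      using mult_left_mono[OF low[OF k(1)], of "real ?m"] by simp
    also have "\<dots> = real ?m * (r + \<epsilon>) - \<epsilon> / 2 * real ?m" by (simp add: algebra_simps)
    also have "\<dots> \<le> real ?m * f k (b J) - \<epsilon> / 2 * real ?m"
      using mult_left_mono[OF high[OF k(2)], of "real ?m"] by simp
    also have "\<dots> < (\<Sum>i<?m. g k i (b J))"
      using approx[of "b J" k] J sJ by (simp add: B_def sum_subtractf)
    finally show False using same by simp
  qed
  then have "inj_on P (Pow {..<n})" by (intro inj_onI subset_antisym) auto
  then have "2 ^ n = card (P ` Pow {..<n})" by (simp add: card_image card_Pow)
  also have "\<dots> \<le> (card X + 1) ^ d"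
  proof (rule sauer_shelah[OF X(1)])
    show "P ` Pow {..<n} \<subseteq> Pow X" by (auto simp: P_def)
    fix A assume A: "A \<subseteq> X" "\<forall>K\<subseteq>A. \<exists>Q\<in>P ` Pow {..<n}. K = A \<inter> Q"
    show "card A < d"
    proof (rule vc)
      show "finite A" using A(1) X(1) by (rule finite_subset)
      show "A \<subseteq> S" using A(1) X(2) by (rule subset_trans)
      show "\<forall>K\<subseteq>A. \<exists>p\<in>Y. K = {h\<in>A. h p = 1}"
      proof (intro allI impI)
        fix K assume "K \<subseteq> A"
        then obtain I where "K = A \<inter> P I" using A(2) by blast
        then have "K = {h\<in>A. h (b I) = 1}" using A(1) by (auto simp: P_def)
        then show "\<exists>p\<in>Y. K = {h\<in>A. h p = 1}" using bY by blast
      qed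
    qed
  qed
  also have "\<dots> \<le> (C * n\<^sup>2 + 1) ^ d" using cX by (intro power_mono) auto
  finally show False using big by simp
qed

section \<open>Instantiating formulas\<close>

lemma eval_inst_trm: "eval_trm U b (inst_trm x a t) = eval_trm U (glue x a b) t"
  by (induction t) (auto simp: glue_def cong: map_cong)

lemma sat_inst: "sat U b (inst x a \<psi>) \<longleftrightarrow> sat U (glue x a b) \<psi>"
proof (induction \<psi> arbitrary: x b)
  case (Exi v \<psi>)
  \<comment> \<open>Since \<open>v\<close> leaves the substituted set, gluing does not overwrite the
    value assigned by the quantifier, even when \<open>v\<close> lies in \<open>x\<close>.\<close>
  have "glue (x - {v}) a (b(v := c)) = (glue x a b)(v := c)" for c
    by (auto simp: glue_def fun_eq_iff)
  then show ?case by (simp only: inst.simps sat.simps Exi.IH)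
qed (auto simp: eval_inst_trm comp_def)

lemma fv_inst_trm: "fv_trm (inst_trm x a t) = fv_trm t - x"
  by (induction t) auto

lemma fv_inst: "fv (inst x a \<psi>) = fv \<psi> - x"
  by (induction \<psi> arbitrary: x) (auto simp: fv_inst_trm)

lemma wf_inst_trm: "wf_trm L A t \<Longrightarrow> a ` x \<subseteq> A \<Longrightarrow> wf_trm L A (inst_trm x a t)"
  by (induction t) auto

lemma wf_inst: "wf_fm L A \<psi> \<Longrightarrow> a ` x \<subseteq> A \<Longrightarrow> wf_fm L A (inst x a \<psi>)"
  by (induction \<psi> arbitrary: x) (auto simp: wf_inst_trm image_subset_iff)

lemma wf_trm_mono: "wf_trm L A t \<Longrightarrow> A \<subseteq> B \<Longrightarrow> wf_trm L B t"
  by (induction t) auto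

lemma wf_fm_mono: "wf_fm L A \<psi> \<Longrightarrow> A \<subseteq> B \<Longrightarrow> wf_fm L B \<psi>"
  by (induction \<psi>) (auto simp: wf_trm_mono)

section \<open>Shattering by types and shattering by tuples\<close>

lemma inst_in_formulas:
  assumes "partitioned_formula L x y \<phi>" "a \<in> x \<rightarrow>\<^sub>E A"
  shows "inst x a \<phi> \<in> formulas L A y"
  using assms wf_inst[OF wf_fm_mono, of L "{}" \<phi> A a x]
  by (auto simp: partitioned_formula_def formulas_def fv_inst)

text \<open>By completeness \<open>p\<close> contains \<open>inst x a \<phi>\<close> or its negation
  for each \<open>a\<close> in \<open>D\<close>, and these finitely many formulas have a common
  solution in \<open>U\<close>. This transfers shattering by types to shattering by tuples, the
  setting of \<open>IP\<close>.\<close>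

lemma type_realised_on_finite:
  assumes p: "p \<in> type_space L U A y" and \<phi>: "partitioned_formula L x y \<phi>"
    and D: "finite D" "D \<subseteq> x \<rightarrow>\<^sub>E A"
  shows "\<exists>b \<in> y \<rightarrow>\<^sub>E univ U. \<forall>a\<in>D. sat U (glue x a b) \<phi> \<longleftrightarrow> inst x a \<phi> \<in> p"
proof -
  let ?\<theta> = "\<lambda>a. if inst x a \<phi> \<in> p then inst x a \<phi> else Neg (inst x a \<phi>)"
  have sub: "?\<theta> ` D \<subseteq> p"
  proof (rule image_subsetI)
    fix a assume "a \<in> D"
    then have "inst x a \<phi> \<in> formulas L A y"
      using D(2) by (intro inst_in_formulas[OF \<phi>]) blast
    then show "?\<theta> a \<in> p" using p unfolding type_space_def by auto
  qed
  have "\<forall>q. finite q \<longrightarrow> q \<subseteq> p \<longrightarrow> (\<exists>b \<in> y \<rightarrow>\<^sub>E univ U. \<forall>\<psi>\<in>q. sat U b \<psi>)"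
    using p by (simp add: type_space_def)
  from this[rule_format, OF finite_imageI[OF D(1)] sub]
  obtain b where b: "b \<in> y \<rightarrow>\<^sub>E univ U" "\<forall>\<psi>\<in>?\<theta> ` D. sat U b \<psi>"
    by (elim bexE) (rule that)
  have "sat U (glue x a b) \<phi> \<longleftrightarrow> inst x a \<phi> \<in> p" if "a \<in> D" for a
  proof -
    have "sat U b (?\<theta> a)" using b(2) that by blast
    then show ?thesis by (auto simp: sat_inst split: if_splits)
  qed
  then show ?thesis using b(1) by blast
qed

theorem theorem3p14:
  fixes L :: "('f, 'r) language"
    and T :: "('f, 'r, 'a) fm set"
    and U M :: "('f, 'r, 'a) struct"
    and \<kappa> :: "'k rel"
    and x y :: "nat set"
    and \<phi> :: "('f, 'r, 'a) fm"
  assumes "countable_language L"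
    and "is_theory L T"
    and "monster_model L T \<kappa> U"
    and "elementary_substructure L M U"
    and "small \<kappa> M"
    and "partitioned_formula L x y \<phi>"
    and "NIP U x y \<phi>"
  shows "seq_dependent (type_space L U (univ M) y) (convex hull (type_funs L U M x y \<phi>))"
proof -
  let ?F = "type_fun L U M x y \<phi>"
  have MU: "univ M \<subseteq> univ U" using assms(4) by (simp add: elementary_substructure_def)
  \<comment> \<open>The negation of \<open>IP\<close> provides a \<open>d\<close> such that no
    shattered set is infinite or has at least \<open>d\<close> elements.\<close>
  from assms(7) obtain d where d: "\<And>D. D \<subseteq> (x \<rightarrow>\<^sub>E univ U) \<Longrightarrow>
      \<forall>K\<subseteq>D. \<exists>b \<in> y \<rightarrow>\<^sub>E univ U. K = {c\<in>D. sat U (glue x c b) \<phi>} \<Longrightarrow> card D < d"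
    unfolding NIP_def IP_def by (meson not_le)
  show ?thesis
  proof (rule convex_hull_seq_dependent)
    show "g p \<in> {0, 1}" if "g \<in> type_funs L U M x y \<phi>" for g p
      using that by (auto simp: type_funs_def type_fun_def)
  next
    fix A
    assume A: "finite A" "A \<subseteq> type_funs L U M x y \<phi>"
      and sh: "\<forall>K\<subseteq>A. \<exists>p\<in>type_space L U (univ M) y. K = {g\<in>A. g p = 1}"
    have "A \<subseteq> ?F ` (x \<rightarrow>\<^sub>E univ M)" using A(2) by (auto simp: type_funs_def)
    \<comment> \<open>Different tuples may induce the same function, so one representative is chosen
      for each. Injectivity preserves cardinality and matches subsets of \<open>D\<close> with
      subsets of \<open>A\<close>.\<close>
    then obtain D where D: "D \<subseteq> x \<rightarrow>\<^sub>E univ M" "inj_on ?F D" "A = ?F ` D"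
      by (meson subset_image_inj)
    have finD: "finite D" using A(1) D finite_image_iff by blast
    have "card D < d"
    proof (rule d)
      show "D \<subseteq> x \<rightarrow>\<^sub>E univ U" using D(1) PiE_mono[of x "\<lambda>_. univ M" "\<lambda>_. univ U"] MU by blast
      show "\<forall>K\<subseteq>D. \<exists>b \<in> y \<rightarrow>\<^sub>E univ U. K = {c\<in>D. sat U (glue x c b) \<phi>}"
      proof (intro allI impI)
        fix K assume K: "K \<subseteq> D"
        then obtain p where p: "p \<in> type_space L U (univ M) y"
          and Kp: "?F ` K = {g\<in>A. g p = 1}"
          using sh D(3) by (meson image_mono)
        obtain b where b: "b \<in> y \<rightarrow>\<^sub>E univ U"
          "\<forall>a\<in>D. sat U (glue x a b) \<phi> \<longleftrightarrow> inst x a \<phi> \<in> p"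
          using type_realised_on_finite[OF p assms(6) finD D(1)] by blast
        have "a \<in> K \<longleftrightarrow> inst x a \<phi> \<in> p" if "a \<in> D" for a
        proof -
          have "a \<in> K \<longleftrightarrow> ?F a \<in> ?F ` K" using inj_on_image_mem_iff[OF D(2) that K] by simp
          also have "\<dots> \<longleftrightarrow> ?F a p = 1" using Kp D(3) that by auto
          also have "\<dots> \<longleftrightarrow> inst x a \<phi> \<in> p" using p by (simp add: type_fun_def)
          finally show ?thesis .
        qed
        then show "\<exists>b \<in> y \<rightarrow>\<^sub>E univ U. K = {c\<in>D. sat U (glue x c b) \<phi>}"
          using b K by (intro bexI[of _ b]) auto
      qed
    qed
    then show "card A < d" using D card_image by metis
  qed
qed

end
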